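(* Let $n \ge 1$. For $S \in \mathcal{Q}_n$ and $u,v \in T_S\mathcal{Q}_n \simeq \mathfrak{p}_n$, put $$(u,v)_S = \left\langle A^{-1}u\,(A^{-1})^{\dagger}\,\middle|\,A^{-1}v\,(A^{-1})^{\dagger}\right\rangle, \qquad ( * )$$ where $A$ is any element of $\mathrm{GL}(n,\mathbb{H})$ such that $S = A\cdot I = AA^{\dagger}$. Then: (i) For each $S \in \mathcal{Q}_n$, formula $( * )$ defines a scalar product on $T_S\mathcal{Q}_n \simeq \mathfrak{p}_n$, which is independent of the choice of $A$. (ii) Moreover, $$(u,v)_S = \mathrm{Re}\,\mathrm{tr}\left(S^{-1}u\,S^{-1}v\right),$$ which yields a Riemannian metric on $\mathcal{Q}_n$. (iii) This Riemannian metric is invariant under the action of $\mathrm{GL}(n,\mathbb{H})$ on $\mathcal{Q}_n$.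
   Context: $\mathbb{H}$ is the division algebra of real quaternions $q = q_0+q_1\mathrm{i}+q_2\mathrm{j}+q_3\mathrm{k}$, with $\mathrm{Re}(q)=q_0$, conjugate $\bar q = q_0-q_1\mathrm{i}-q_2\mathrm{j}-q_3\mathrm{k}$. $M_n(\mathbb{H})$ is the set of $n\times n$ quaternion matrices with the product $(AB)_{ij}=\sum_l A_{il}B_{lj}$; $I$ is the identity matrix; $A^{\dagger}$ is the conjugate-transpose, $A^{\dagger}_{ij}=\bar{A}_{ji}$. $\mathrm{GL}(n,\mathbb{H})$ is the group of invertible elements of $M_n(\mathbb{H})$. On $M_n(\mathbb{H})=\mathfrak{gl}(n,\mathbb{H})$ define $\langle X|Y\rangle = \mathrm{Re}\,\mathrm{tr}(XY^{\dagger})$. $\mathfrak{p}_n$ is the real vector space of $X\in M_n(\mathbb{H})$ with $X=X^{\dagger}$. $\mathcal{Q}_n$ is the space of positive-definite quaternion matrices: all $S \in M_n(\mathbb{H})$ with $S=S^{\dagger}$ and $\sum_{i,j}\bar{x}_iS_{ij}x_j>0$ for all non-zero $(x_1,\ldots,x_n)\in\mathbb{H}^n$. $\mathcal{Q}_n$ is an open subset of $\mathfrak{p}_n$, hence a real smooth manifold whose tangent space $T_S\mathcal{Q}_n$ at each $S$ is identified with $\mathfrak{p}_n$. The group $\mathrm{GL}(n,\mathbb{H})$ acts on $\mathcal{Q}_n$ on the left by $A\cdot S = ASA^{\dagger}$, and this action is transitive; in particular every $S\in\mathcal{Q}_n$ can be written $S=AA^{\dagger}$ with $A \in \mathrm{GL}(n,\mathbb{H})$.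 *)

theory Defs
  imports "HOL-Analysis.Analysis"
begin

section \<open>The real quaternions\<close>

datatype quat = Quat (qRe: real) (qI: real) (qJ: real) (qK: real)

lemma quat_eq_iff: "p = q \<longleftrightarrow> qRe p = qRe q \<and> qI p = qI q \<and> qJ p = qJ q \<and> qK p = qK q"
  by (cases p; cases q) simp

lemmas quat_eqI = quat_eq_iff[THEN iffD2]

instantiation quat :: ab_group_add
begin

definition "0 = Quat 0 0 0 0"
definition "p + q = Quat (qRe p + qRe q) (qI p + qI q) (qJ p + qJ q) (qK p + qK q)"
definition "- p = Quat (- qRe p) (- qI p) (- qJ p) (- qK p)"
definition "p - q = Quat (qRe p - qRe q) (qI p - qI q) (qJ p - qJ q) (qK p - qK q)"

instance
  by standard (auto simp: quat_eq_iff zero_quat_def plus_quat_def uminus_quat_def minus_quat_def)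

end

lemma quat_zero_sel [simp]: "qRe 0 = 0" "qI 0 = 0" "qJ 0 = 0" "qK 0 = 0"
  by (simp_all add: zero_quat_def)

lemma quat_plus_sel [simp]:
  "qRe (p + q) = qRe p + qRe q" "qI (p + q) = qI p + qI q"
  "qJ (p + q) = qJ p + qJ q" "qK (p + q) = qK p + qK q"
  by (simp_all add: plus_quat_def)

lemma quat_uminus_sel [simp]:
  "qRe (- p) = - qRe p" "qI (- p) = - qI p" "qJ (- p) = - qJ p" "qK (- p) = - qK p"
  by (simp_all add: uminus_quat_def)

lemma quat_minus_sel [simp]:
  "qRe (p - q) = qRe p - qRe q" "qI (p - q) = qI p - qI q"
  "qJ (p - q) = qJ p - qJ q" "qK (p - q) = qK p - qK q"
  by (simp_all add: minus_quat_def)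

instantiation quat :: ring_1
begin

definition "1 = Quat 1 0 0 0"

definition "p * q = Quat
  (qRe p * qRe q - qI p * qI q - qJ p * qJ q - qK p * qK q)
  (qRe p * qI q + qI p * qRe q + qJ p * qK q - qK p * qJ q)
  (qRe p * qJ q - qI p * qK q + qJ p * qRe q + qK p * qI q)
  (qRe p * qK q + qI p * qJ q - qJ p * qI q + qK p * qRe q)"

instance
proof
  fix p q r :: quat
  show "p * q * r = p * (q * r)"
    unfolding quat_eq_iff times_quat_def quat.sel by (intro conjI; algebra)
  show "(p + q) * r = p * r + q * r" "p * (q + r) = p * q + p * r"
    by (simp_all add: quat_eq_iff times_quat_def algebra_simps)
  show "1 * p = p" "p * 1 = p" "(0 :: quat) \<noteq> 1"
    by (simp_all add: quat_eq_iff times_quat_def one_quat_def)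
qed

end

lemma quat_one_sel [simp]: "qRe 1 = 1" "qI 1 = 0" "qJ 1 = 0" "qK 1 = 0"
  by (simp_all add: one_quat_def)

lemma quat_times_sel:
  "qRe (p * q) = qRe p * qRe q - qI p * qI q - qJ p * qJ q - qK p * qK q"
  "qI (p * q) = qRe p * qI q + qI p * qRe q + qJ p * qK q - qK p * qJ q"
  "qJ (p * q) = qRe p * qJ q - qI p * qK q + qJ p * qRe q + qK p * qI q"
  "qK (p * q) = qRe p * qK q + qI p * qJ q - qJ p * qI q + qK p * qRe q"
  by (simp_all add: times_quat_def)

lemma quat_units:
  defines "i \<equiv> Quat 0 1 0 0" and "j \<equiv> Quat 0 0 1 0" and "k \<equiv> Quat 0 0 0 1"
  shows "i * i = - 1" "j * j = - 1" "k * k = - 1" "i * j = k" "j * k = i" "k * i = j"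
    "j * i = - k" "k * j = - i" "i * k = - j"
  by (simp_all add: assms quat_eq_iff quat_times_sel)

instantiation quat :: real_algebra_1
begin

definition "scaleR r q = Quat (r * qRe q) (r * qI q) (r * qJ q) (r * qK q)"

instance
  by standard (auto simp: quat_eq_iff scaleR_quat_def quat_times_sel algebra_simps)

end

lemma quat_scaleR_sel [simp]:
  "qRe (r *\<^sub>R q) = r * qRe q" "qI (r *\<^sub>R q) = r * qI q"
  "qJ (r *\<^sub>R q) = r * qJ q" "qK (r *\<^sub>R q) = r * qK q"
  by (simp_all add: scaleR_quat_def)

lemma of_real_quat: "(of_real r :: quat) = Quat r 0 0 0"
  by (simp add: of_real_def quat_eq_iff)

definition qcnj :: "quat \<Rightarrow> quat"
  where "qcnj q = Quat (qRe q) (- qI q) (- qJ q) (- qK q)"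

instantiation quat :: real_inner
begin

definition "inner p q = qRe p * qRe q + qI p * qI q + qJ p * qJ q + qK p * qK q"
definition "norm (q :: quat) = sqrt (inner q q)"
definition "sgn (q :: quat) = q /\<^sub>R norm q"
definition "dist (p :: quat) q = norm (p - q)"
definition "(uniformity :: (quat \<times> quat) filter) =
  (INF e\<in>{0 <..}. principal {(x, y). dist x y < e})"
definition "open (U :: quat set) \<longleftrightarrow>
  (\<forall>x\<in>U. eventually (\<lambda>(x', y). x' = x \<longrightarrow> y \<in> U) uniformity)"

instance
proof
  fix p q r :: quat and a :: real and U :: "quat set"
  show "inner p q = inner q p"
    by (simp add: inner_quat_def mult.commute)
  show "inner (p + q) r = inner p r + inner q r"
    by (simp add: inner_quat_def algebra_simps)
  show "inner (a *\<^sub>R p) q = a * inner p q"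
    by (simp add: inner_quat_def algebra_simps)
  show "0 \<le> inner p p"
    by (simp add: inner_quat_def)
  show "inner p p = 0 \<longleftrightarrow> p = 0"
    by (auto simp: inner_quat_def quat_eq_iff add_nonneg_eq_0_iff)
  show "norm p = sqrt (inner p p)"
    by (rule norm_quat_def)
  show "sgn p = p /\<^sub>R norm p"
    by (rule sgn_quat_def)
  show "dist p q = norm (p - q)"
    by (rule dist_quat_def)
  show "(uniformity :: (quat \<times> quat) filter) =
      (INF e\<in>{0 <..}. principal {(x, y). dist x y < e})"
    by (rule uniformity_quat_def)
  show "open U \<longleftrightarrow> (\<forall>x\<in>U. \<forall>\<^sub>F (x', y) in uniformity. x' = x \<longrightarrow> y \<in> U)"
    by (rule open_quat_def)
qed

end

instantiation quat :: real_normed_div_algebra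
begin

definition "inverse q = qcnj q /\<^sub>R (norm q)\<^sup>2"
definition "p div (q :: quat) = p * inverse q"

instance
proof
  fix p q :: quat
  have n2: "(norm x)\<^sup>2 = qRe x * qRe x + qI x * qI x + qJ x * qJ x + qK x * qK x" for x :: quat
    by (simp add: power2_norm_eq_inner inner_quat_def)
  have "(norm (p * q))\<^sup>2 = (norm p * norm q)\<^sup>2"
    unfolding power_mult_distrib n2 quat_times_sel by algebra
  then show "norm (p * q) = norm p * norm q"
    by (rule power2_eq_imp_eq) simp_all
  have cnj: "x * qcnj x = of_real ((norm x)\<^sup>2)" "qcnj x * x = of_real ((norm x)\<^sup>2)" for x
    by (simp_all add: n2 quat_eq_iff quat_times_sel qcnj_def of_real_quat)
  show "q \<noteq> 0 \<Longrightarrow> inverse q * q = 1" "q \<noteq> 0 \<Longrightarrow> q * inverse q = 1"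
    by (simp_all add: inverse_quat_def cnj of_real_def)
  show "p div q = p * inverse q"
    by (rule divide_quat_def)
  show "inverse (0 :: quat) = 0"
    by (simp add: inverse_quat_def qcnj_def quat_eq_iff)
qed

end

instantiation quat :: euclidean_space
begin

definition "(Basis :: quat set) = {Quat 1 0 0 0, Quat 0 1 0 0, Quat 0 0 1 0, Quat 0 0 0 1}"

instance
proof
  show "(Basis :: quat set) \<noteq> {}" "finite (Basis :: quat set)"
    by (simp_all add: Basis_quat_def)
  show "inner u v = (if u = v then 1 else 0)" if "u \<in> Basis" "v \<in> Basis" for u v :: quat
    using that unfolding Basis_quat_def
    by (elim insertE emptyE) (simp_all add: inner_quat_def)
  show "(\<forall>u\<in>Basis. inner x u = 0) \<longleftrightarrow> x = 0" for x :: quat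
    by (simp add: Basis_quat_def inner_quat_def quat_eq_iff [of x])
qed

end

section \<open>Quaternion matrices\<close>

definition ctranspose :: "quat^'n^'m \<Rightarrow> quat^'m^'n"
  where "ctranspose A = (\<chi> i j. qcnj (A $ j $ i))"

definition GL :: "(quat^'n^'n) set"
  where "GL = {A. invertible A}"

definition mat_inner :: "quat^'n^'n \<Rightarrow> quat^'n^'n \<Rightarrow> real"
  where "mat_inner X Y = qRe (trace (X ** ctranspose Y))"

definition selfadj_mats :: "(quat^'n^'n) set"
  where "selfadj_mats = {X. X = ctranspose X}"

text \<open>
  A quaternion is positive when it is a positive real number; this is how the condition
  on the quadratic form is to be read.
\<close>

definition posdef_mats :: "(quat^'n^'n) set"
  where "posdef_mats = {S. S = ctranspose S \<and>
    (\<forall>x :: quat^'n. x \<noteq> 0 \<longrightarrow>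
      (\<exists>r::real. r > 0 \<and> (\<Sum>i\<in>UNIV. \<Sum>j\<in>UNIV. qcnj (x $ i) * S $ i $ j * x $ j) = of_real r))}"

definition gl_act :: "quat^'n^'n \<Rightarrow> quat^'n^'n \<Rightarrow> quat^'n^'n"
  where "gl_act A S = A ** S ** ctranspose A"

section \<open>Riemannian metrics on relatively open subsets of a real vector space\<close>

definition scalar_product_on :: "'a::real_vector set \<Rightarrow> ('a \<Rightarrow> 'a \<Rightarrow> real) \<Rightarrow> bool"
  where "scalar_product_on V b \<longleftrightarrow>
    (\<forall>u\<in>V. \<forall>v\<in>V. \<forall>w\<in>V. b (u + v) w = b u w + b v w) \<and>
    (\<forall>u\<in>V. \<forall>w\<in>V. \<forall>c. b (c *\<^sub>R u) w = c * b u w) \<and>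
    (\<forall>u\<in>V. \<forall>v\<in>V. b u v = b v u) \<and>
    (\<forall>u\<in>V. u \<noteq> 0 \<longrightarrow> b u u > 0)"

text \<open>
  Here \<open>V\<close> is a finite-dimensional subspace and \<open>U\<close> is open in \<open>V\<close>.  The derivative within \<open>U\<close>
  is then uniquely determined on \<open>V\<close> (its values off \<open>V\<close> are irrelevant and never used), and
  \<open>C\<^sup>k\<close> is defined by requiring all directional derivatives along \<open>V\<close> to be \<open>C\<^sup>k\<^sup>-\<^sup>1\<close>.
\<close>

primrec Ck_on ::
  "nat \<Rightarrow> 'a::real_normed_vector set \<Rightarrow> 'a set \<Rightarrow> ('a \<Rightarrow> 'b::real_normed_vector) \<Rightarrow> bool"
where
  "Ck_on 0 V U f \<longleftrightarrow> continuous_on U f"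
| "Ck_on (Suc k) V U f \<longleftrightarrow>
    (\<exists>D. (\<forall>x\<in>U. (f has_derivative D x) (at x within U)) \<and>
         (\<forall>v\<in>V. Ck_on k V U (\<lambda>x. D x v)))"

definition smooth_on ::
  "'a::real_normed_vector set \<Rightarrow> 'a set \<Rightarrow> ('a \<Rightarrow> 'b::real_normed_vector) \<Rightarrow> bool"
  where "smooth_on V U f \<longleftrightarrow> (\<forall>k. Ck_on k V U f)"

text \<open>
  The manifold is \<open>U\<close>, an open subset of the subspace \<open>V\<close>, with every tangent space identified
  with \<open>V\<close>; a vector field on it is a map from \<open>U\<close> to \<open>V\<close>.  The metric tensor is smooth when it
  sends pairs of smooth vector fields to smooth functions.
\<close>

definition riemannian_metric_on ::
  "'a::euclidean_space set \<Rightarrow> 'a set \<Rightarrow> ('a \<Rightarrow> 'a \<Rightarrow> 'a \<Rightarrow> real) \<Rightarrow> bool"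
  where "riemannian_metric_on V U g \<longleftrightarrow>
    subspace V \<and> openin (top_of_set V) U \<and>
    (\<forall>x\<in>U. scalar_product_on V (g x)) \<and>
    (\<forall>X Y. X ` U \<subseteq> V \<and> smooth_on V U X \<and> Y ` U \<subseteq> V \<and> smooth_on V U Y \<longrightarrow>
      smooth_on V U (\<lambda>x. g x (X x) (Y x)))"

text \<open>
  The pullback of \<open>g\<close> along the map \<open>\<phi>\<close> is \<open>g\<close>.  Again the differential is unique on \<open>V\<close>.
\<close>

definition metric_invariant_under ::
  "'a::euclidean_space set \<Rightarrow> 'a set \<Rightarrow> ('a \<Rightarrow> 'a \<Rightarrow> 'a \<Rightarrow> real) \<Rightarrow> ('a \<Rightarrow> 'a) \<Rightarrow> bool"
  where "metric_invariant_under V U g \<phi> \<longleftrightarrow>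
    \<phi> ` U \<subseteq> U \<and>
    (\<forall>x\<in>U. \<exists>D. (\<phi> has_derivative D) (at x within U) \<and> D ` V \<subseteq> V \<and>
      (\<forall>u\<in>V. \<forall>v\<in>V. g (\<phi> x) (D u) (D v) = g x u v))"

section \<open>The metric on positive-definite matrices\<close>

definition metric_via :: "quat^'n^'n \<Rightarrow> quat^'n^'n \<Rightarrow> quat^'n^'n \<Rightarrow> real"
  where "metric_via A u v =
    mat_inner (matrix_inv A ** u ** ctranspose (matrix_inv A))
              (matrix_inv A ** v ** ctranspose (matrix_inv A))"

text \<open>
  Outside the positive-definite matrices no such \<open>A\<close> exists and the value below is meaningless.
\<close>

definition posdef_metric :: "quat^'n^'n \<Rightarrow> quat^'n^'n \<Rightarrow> quat^'n^'n \<Rightarrow> real"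
  where "posdef_metric S = metric_via (SOME A. A \<in> GL \<and> S = gl_act A (mat 1))"

end

theory Submission
  imports Defs
begin

text \<open>
  Everything follows from the trace formula in (ii) and from the existence of a factor \<open>A\<close>.  The
  form \<open>\<langle>X|Y\<rangle>\<close> is the Euclidean inner product on the \<open>4 n\<^sup>2\<close> real coordinates
  (\<open>mat_inner_eq_inner\<close>), and \<open>(\<cdot>,\<cdot>)\<^sub>S\<close> is its pullback by the linear isomorphism
  \<open>u \<mapsto> A\<^sup>-\<^sup>1 u (A\<^sup>-\<^sup>1)\<^sup>\<dagger>\<close>; hence it is a scalar product.  Although \<open>\<H>\<close> is not commutative, the real
  part of the trace is cyclic (\<open>qRe_trace_commute\<close>), and cycling one factor gives
  \<open>Re tr (S\<^sup>-\<^sup>1 u S\<^sup>-\<^sup>1 v)\<close> (\<open>metric_via_eq_trace\<close>), where \<open>A\<close> no longer occurs.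

  A factor exists by Cholesky elimination (\<open>posdef_factorization\<close>).  The dimension is a type, so
  the induction is not on the size of the matrix but on the set of rows already equal to rows of
  the identity.

  For the Riemannian metric two analytic facts are needed.  The positive-definite matrices are
  relatively open (\<open>openin_posdef_mats\<close>): translating by the action, it suffices to see that the
  identity is an interior point.  The metric is smooth since it is the real trace of a product of \<open>S\<^sup>-\<^sup>1\<close>, \<open>u\<close> and \<open>v\<close>, and
  \<open>S \<mapsto> S\<^sup>-\<^sup>1\<close> is smooth because its derivative \<open>v \<mapsto> - S\<^sup>-\<^sup>1 v S\<^sup>-\<^sup>1\<close> is again built from
  it (\<open>Ck_on_matrix_inv\<close>).

  Invariance uses the definition through factors: if \<open>S = B B\<^sup>\<dagger>\<close> then \<open>A B\<close> is a factor of \<open>A \<cdot> S\<close>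
  (\<open>posdef_metric_invariant\<close>).
\<close>

section \<open>Quaternion matrices and their inner product\<close>

lemma qcnj_sel [simp]: "qRe (qcnj q) = qRe q" "qI (qcnj q) = - qI q"
  "qJ (qcnj q) = - qJ q" "qK (qcnj q) = - qK q"
  by (simp_all add: qcnj_def)

lemma qcnj_simps [simp]:
  "qcnj (qcnj p) = p" "qcnj 0 = 0" "qcnj 1 = 1" "qcnj (p + q) = qcnj p + qcnj q"
  "qcnj (p - q) = qcnj p - qcnj q" "qcnj (c *\<^sub>R p) = c *\<^sub>R qcnj p"
  by (simp_all add: quat_eq_iff)

lemma qcnj_mult: "qcnj (p * q) = qcnj q * qcnj p"
  by (simp add: quat_eq_iff quat_times_sel)

lemma qcnj_sum: "qcnj (sum f I) = (\<Sum>i\<in>I. qcnj (f i))"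
  by (induction I rule: infinite_finite_induct) auto

lemma qRe_sum: "qRe (sum f I) = (\<Sum>i\<in>I. qRe (f i))"
  by (induction I rule: infinite_finite_induct) auto

lemma qcnj_eq_self_imp_of_real: "q = of_real (qRe q)" if "qcnj q = q"
  using that by (simp add: quat_eq_iff of_real_quat)

lemma norm_qcnj [simp]: "norm (qcnj q) = norm q"
  by (simp add: norm_quat_def inner_quat_def)

lemma ctranspose_nth [simp]: "ctranspose A $ i $ j = qcnj (A $ j $ i)"
  by (simp add: ctranspose_def)

lemma mat_nth: "mat c $ i $ j = (if i = j then c else 0)"
  by (simp add: mat_def)

lemma ctranspose_simps [simp]:
  "ctranspose (ctranspose A) = A" "ctranspose (A + B) = ctranspose A + ctranspose B"
  "ctranspose (A - B) = ctranspose A - ctranspose B"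
  "ctranspose (c *\<^sub>R A) = c *\<^sub>R ctranspose A" "ctranspose 0 = 0" "ctranspose (mat 1) = mat 1"
  by (simp_all add: vec_eq_iff mat_nth)

lemma ctranspose_mult: "ctranspose (A ** B) = ctranspose B ** ctranspose A"
  by (simp add: vec_eq_iff matrix_matrix_mult_def qcnj_sum qcnj_mult)

text \<open>
  Multiplication in \<open>\<H>\<close> is not commutative, so the trace itself is not cyclic; but
  \<open>Re (p q) = Re (q p)\<close>, and hence the real part of the trace is.
\<close>

lemma qRe_trace_commute: "qRe (trace (A ** B)) = qRe (trace (B ** A))"
  for A :: "quat^'m^'n" and B :: "quat^'n^'m"
proof -
  have "qRe (trace (A ** B)) = (\<Sum>i\<in>UNIV. \<Sum>j\<in>UNIV. qRe (A $ i $ j * B $ j $ i))"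
    by (simp add: trace_def matrix_matrix_mult_def qRe_sum)
  also have "\<dots> = (\<Sum>j\<in>UNIV. \<Sum>i\<in>UNIV. qRe (B $ j $ i * A $ i $ j))"
    by (subst sum.swap) (simp add: quat_times_sel mult.commute)
  also have "\<dots> = qRe (trace (B ** A))"
    by (simp add: trace_def matrix_matrix_mult_def qRe_sum)
  finally show ?thesis .
qed

text \<open>
  The form \<open>\<langle>X|Y\<rangle>\<close> is the Euclidean inner product of the entries, so it is bilinear, symmetric
  and definite without further work.
\<close>

lemma mat_inner_eq_inner: "mat_inner X Y = X \<bullet> Y"
  by (simp add: mat_inner_def trace_def matrix_matrix_mult_def inner_vec_def qRe_sum
      inner_quat_def quat_times_sel)

lemma bounded_bilinear_matrix_mult:
  "bounded_bilinear ((**) :: quat^'m^'n \<Rightarrow> quat^'p^'m \<Rightarrow> quat^'p^'n)"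
proof -
  have "bilinear ((**) :: quat^'m^'n \<Rightarrow> quat^'p^'m \<Rightarrow> quat^'p^'n)"
    unfolding bilinear_def
    by (intro conjI allI linearI)
       (simp_all add: vec_eq_iff matrix_matrix_mult_def algebra_simps sum.distrib scaleR_sum_right)
  then show ?thesis
    by (simp only: bilinear_conv_bounded_bilinear)
qed

section \<open>The action of the general linear group\<close>

lemma matrix_inv_unique:
  fixes A B :: "quat^'n^'n"
  assumes "A ** B = mat 1" "B ** A = mat 1"
  shows "matrix_inv A = B"
proof -
  have inv: "A ** matrix_inv A = mat 1 \<and> matrix_inv A ** A = mat 1"
    unfolding matrix_inv_def by (rule someI[of _ B]) (simp add: assms)
  have "matrix_inv A = matrix_inv A ** (A ** B)"
    by (simp add: assms)
  then show ?thesis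
    using inv by (simp add: matrix_mul_assoc)
qed

lemma GL_I: "A ** B = mat 1 \<Longrightarrow> B ** A = mat 1 \<Longrightarrow> A \<in> GL"
  unfolding GL_def invertible_def by blast

lemma GL_inverse:
  fixes A :: "quat^'n^'n"
  assumes "A \<in> GL"
  shows "A ** matrix_inv A = mat 1" "matrix_inv A ** A = mat 1"
proof -
  obtain B where "A ** B = mat 1" "B ** A = mat 1"
    using assms by (auto simp: GL_def invertible_def)
  then show "A ** matrix_inv A = mat 1" "matrix_inv A ** A = mat 1"
    using matrix_inv_unique by metis+
qed

lemma matrix_inv_GL: "A \<in> GL \<Longrightarrow> matrix_inv A \<in> GL"
  by (rule GL_I) (rule GL_inverse, assumption)+

lemma
  fixes A B :: "quat^'n^'n"
  assumes "A \<in> GL" "B \<in> GL"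
  shows GL_mult: "A ** B \<in> GL"
    and matrix_inv_mult: "matrix_inv (A ** B) = matrix_inv B ** matrix_inv A"
proof -
  let ?I = "matrix_inv B ** matrix_inv A"
  have "A ** B ** ?I = A ** (B ** matrix_inv B) ** matrix_inv A"
    by (simp only: matrix_mul_assoc)
  then have 1: "A ** B ** ?I = mat 1"
    by (simp add: assms GL_inverse)
  have "?I ** (A ** B) = matrix_inv B ** (matrix_inv A ** A) ** B"
    by (simp only: matrix_mul_assoc)
  then have 2: "?I ** (A ** B) = mat 1"
    by (simp add: assms GL_inverse)
  show "A ** B \<in> GL" "matrix_inv (A ** B) = ?I"
    using GL_I[OF 1 2] matrix_inv_unique[OF 1 2] by simp_all
qed

lemma
  fixes A :: "quat^'n^'n"
  assumes "A \<in> GL"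
  shows GL_ctranspose: "ctranspose A \<in> GL"
    and matrix_inv_ctranspose: "matrix_inv (ctranspose A) = ctranspose (matrix_inv A)"
proof -
  have *: "ctranspose A ** ctranspose (matrix_inv A) = mat 1"
    "ctranspose (matrix_inv A) ** ctranspose A = mat 1"
    by (simp_all add: ctranspose_mult[symmetric] GL_inverse assms)
  show "ctranspose A \<in> GL" "matrix_inv (ctranspose A) = ctranspose (matrix_inv A)"
    using GL_I[OF *] matrix_inv_unique[OF *] by simp_all
qed

lemma gl_act_mat_1 [simp]: "gl_act (mat 1) X = X"
  by (simp add: gl_act_def)

lemma gl_act_gl_act: "gl_act A (gl_act B X) = gl_act (A ** B) X"
  by (simp add: gl_act_def ctranspose_mult matrix_mul_assoc)

lemma gl_act_cancel [simp]:
  assumes "A \<in> GL"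
  shows "gl_act A (gl_act (matrix_inv A) X) = X" "gl_act (matrix_inv A) (gl_act A X) = X"
  by (simp_all add: gl_act_gl_act GL_inverse assms)

lemma bounded_linear_two_sided_mult:
  fixes A B :: "quat^'n^'n"
  shows "bounded_linear (\<lambda>X. A ** X ** B)"
proof -
  interpret bounded_bilinear "(**) :: quat^'n^'n \<Rightarrow> quat^'n^'n \<Rightarrow> quat^'n^'n"
    by (rule bounded_bilinear_matrix_mult)
  have "linear (\<lambda>X. A ** X ** B)"
    by (rule linearI) (simp_all only: add_left add_right scaleR_left scaleR_right)
  then show ?thesis
    by (simp only: linear_conv_bounded_linear)
qed

lemma bounded_linear_gl_act: "bounded_linear (gl_act A)"
  using bounded_linear_two_sided_mult[of A "ctranspose A"]
  by (simp add: gl_act_def[abs_def])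

lemma selfadj_mats_iff: "X \<in> selfadj_mats \<longleftrightarrow> ctranspose X = X"
  by (auto simp: selfadj_mats_def)

lemma gl_act_selfadj: "X \<in> selfadj_mats \<Longrightarrow> gl_act A X \<in> selfadj_mats"
  by (simp add: selfadj_mats_iff gl_act_def ctranspose_mult matrix_mul_assoc)

lemma subspace_selfadj_mats: "subspace selfadj_mats"
  by (simp add: subspace_def selfadj_mats_iff)

text \<open>
  The adjoint of the action of \<open>A\<close> is the action of \<open>A\<^sup>\<dagger>\<close>, by cycling \<open>A\<close> to the end of the trace.
  Applied to \<open>Y = x x\<^sup>\<dagger>\<close> this moves a change of matrix to a change of test vector.
\<close>

lemma inner_gl_act: "gl_act A X \<bullet> Y = X \<bullet> gl_act (ctranspose A) Y"
proof -
  have "gl_act A X \<bullet> Y = qRe (trace (A ** (X ** ctranspose A ** ctranspose Y)))"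
    by (simp add: mat_inner_eq_inner[symmetric] mat_inner_def gl_act_def matrix_mul_assoc)
  also have "\<dots> = qRe (trace (X ** ctranspose A ** ctranspose Y ** A))"
    by (rule qRe_trace_commute)
  also have "\<dots> = X \<bullet> gl_act (ctranspose A) Y"
    by (simp add: mat_inner_eq_inner[symmetric] mat_inner_def gl_act_def ctranspose_mult
        matrix_mul_assoc)
  finally show ?thesis .
qed

section \<open>Positive-definite matrices\<close>

definition outer :: "quat^'n \<Rightarrow> quat^'n^'n"
  where "outer x = (\<chi> i j. x $ i * qcnj (x $ j))"

lemma gl_act_outer: "gl_act A (outer x) = outer (A *v x)"
proof -
  have "gl_act A (outer x) $ i $ j = outer (A *v x) $ i $ j" for i j
    by (simp add: gl_act_def outer_def matrix_matrix_mult_def matrix_vector_mult_def qcnj_sum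
        qcnj_mult sum_distrib_left sum_distrib_right mult.assoc)
  then show ?thesis
    by (simp add: vec_eq_iff)
qed

lemma norm_outer: "norm (outer x) = (norm x)\<^sup>2"
proof -
  have "(norm (outer x))\<^sup>2 = (\<Sum>i\<in>UNIV. \<Sum>j\<in>UNIV. (norm (x $ i))\<^sup>2 * (norm (x $ j))\<^sup>2)"
    by (simp add: norm_vec_def L2_set_def sum_nonneg outer_def norm_mult power_mult_distrib)
  also have "\<dots> = ((norm x)\<^sup>2)\<^sup>2"
    by (simp add: norm_vec_def L2_set_def sum_nonneg sum_product power2_eq_square[of "sum _ _"])
  finally show ?thesis
    by (rule power2_eq_imp_eq) simp_all
qed

lemma inner_mat_1_outer: "mat 1 \<bullet> outer x = (norm x)\<^sup>2"
proof -
  have "(mat 1 $ i $ j) \<bullet> (outer x $ i $ j) = (if j = i then x $ i \<bullet> x $ i else 0)" for i j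
    by (simp add: mat_nth outer_def inner_quat_def quat_times_sel)
  then show ?thesis
    by (simp add: inner_vec_def power2_norm_eq_inner)
qed

text \<open>
  On self-adjoint matrices the quadratic form is real-valued, because its value is its own
  conjugate, and it is linear in the matrix: it pairs the matrix with \<open>x x\<^sup>\<dagger>\<close>.  This reduces
  positivity to Euclidean geometry of matrices.
\<close>

lemma quadratic_form_eq_inner_outer:
  assumes "S \<in> selfadj_mats"
  shows "(\<Sum>i\<in>UNIV. \<Sum>j\<in>UNIV. qcnj (x $ i) * S $ i $ j * x $ j) = of_real (S \<bullet> outer x)"
    (is "?q = _")
proof -
  have S: "qcnj (S $ i $ j) = S $ j $ i" for i j
    using assms by (metis ctranspose_nth selfadj_mats_iff)
  have "qcnj ?q = (\<Sum>i\<in>UNIV. \<Sum>j\<in>UNIV. qcnj (x $ j) * S $ j $ i * x $ i)"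
    by (simp add: qcnj_sum qcnj_mult S mult.assoc)
  also have "\<dots> = ?q"
    by (rule sum.swap)
  finally have "?q = of_real (qRe ?q)"
    by (rule qcnj_eq_self_imp_of_real)
  moreover have "qRe (qcnj p * s * q) = s \<bullet> (p * qcnj q)" for p s q
    by (simp add: inner_quat_def quat_times_sel algebra_simps)
  then have "qRe ?q = S \<bullet> outer x"
    by (simp add: qRe_sum inner_vec_def outer_def)
  ultimately show ?thesis
    by simp
qed

lemma posdef_mats_iff:
  "S \<in> posdef_mats \<longleftrightarrow> S \<in> selfadj_mats \<and> (\<forall>x. x \<noteq> 0 \<longrightarrow> 0 < S \<bullet> outer x)"
proof (cases "S \<in> selfadj_mats")
  case True
  then show ?thesis
    by (simp add: posdef_mats_def quadratic_form_eq_inner_outer)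
       (simp add: selfadj_mats_def)
next
  case False
  then show ?thesis
    by (auto simp: posdef_mats_def selfadj_mats_def)
qed

lemma posdef_selfadj: "S \<in> posdef_mats \<Longrightarrow> S \<in> selfadj_mats"
  by (simp add: posdef_mats_iff)

lemma gl_act_posdef:
  assumes A: "A \<in> GL" and S: "S \<in> posdef_mats"
  shows "gl_act A S \<in> posdef_mats"
proof -
  have "ctranspose A *v x \<noteq> 0" if "x \<noteq> 0" for x
  proof
    assume "ctranspose A *v x = 0"
    then have "matrix_inv (ctranspose A) *v (ctranspose A *v x) = 0"
      by simp
    then show False
      using that by (simp add: matrix_vector_mul_assoc GL_inverse GL_ctranspose A)
  qed
  then show ?thesis
    using S by (auto simp: posdef_mats_iff gl_act_selfadj inner_gl_act gl_act_outer)
qed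

text \<open>The diagonal entry is the value of the quadratic form at the \<open>k\<close>-th basis vector.\<close>

lemma posdef_diagonal:
  assumes "S \<in> posdef_mats"
  obtains r where "0 < r" "S $ k $ k = of_real r"
proof
  have *: "S $ i $ j \<bullet> outer (axis k 1) $ i $ j = (if j = k then if i = k then qRe (S $ k $ k) else 0 else 0)"
    for i j
    by (simp add: outer_def axis_def inner_quat_def)
  have "S \<bullet> outer (axis k 1) = qRe (S $ k $ k)"
    unfolding inner_vec_def * by simp
  moreover have "axis k (1 :: quat) \<noteq> 0"
    by (simp add: axis_eq_0_iff)
  ultimately show "0 < qRe (S $ k $ k)"
    using assms by (metis posdef_mats_iff)
  have "qcnj (S $ k $ k) = S $ k $ k"
    using posdef_selfadj[OF assms] by (metis ctranspose_nth selfadj_mats_iff)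
  then show "S $ k $ k = of_real (qRe (S $ k $ k))"
    by (rule qcnj_eq_self_imp_of_real)
qed

section \<open>Factorization of positive-definite matrices\<close>

text \<open>
  Elementary matrices that agree with the identity outside column \<open>k\<close>: multiplication by one of
  them on the left adds multiples of row \<open>k\<close> to the other rows and rescales row \<open>k\<close>.
\<close>

definition replace_col :: "'n \<Rightarrow> quat^'n \<Rightarrow> quat^'n^'n"
  where "replace_col k c = (\<chi> i j. if j = k then c $ i else mat 1 $ i $ j)"

lemma replace_col_mult_nth:
  "(replace_col k c ** X) $ i $ j = (if i = k then 0 else X $ i $ j) + c $ i * X $ k $ j"
proof -
  have "replace_col k c $ i $ l * X $ l $ j =
      (if l = i then (if i = k then 0 else X $ i $ j) else 0) +
      (if l = k then c $ i * X $ k $ j else 0)" for l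
    by (auto simp: replace_col_def mat_nth)
  then show ?thesis
    by (simp add: matrix_matrix_mult_def sum.distrib)
qed

lemma replace_col_GL:
  assumes "c $ k \<noteq> 0"
  shows "replace_col k c \<in> GL"
proof (rule GL_I)
  let ?d = "\<chi> i. if i = k then inverse (c $ k) else - (c $ i * inverse (c $ k))"
  show "replace_col k c ** replace_col k ?d = mat 1"
    "replace_col k ?d ** replace_col k c = mat 1"
    using assms
    by (auto simp: vec_eq_iff replace_col_mult_nth) (auto simp: replace_col_def mat_nth mult.assoc)
qed

lemma gl_act_replace_col_nth:
  "gl_act (replace_col k c) X $ i $ j =
    (if i = k then 0 else (if j = k then 0 else X $ i $ j) + X $ i $ k * qcnj (c $ j)) +
    c $ i * ((if j = k then 0 else X $ k $ j) + X $ k $ k * qcnj (c $ j))"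
proof -
  have "gl_act (replace_col k c) X =
      replace_col k c ** ctranspose (replace_col k c ** ctranspose X)"
    by (simp add: gl_act_def ctranspose_mult matrix_mul_assoc)
  then show ?thesis
    by (simp add: replace_col_mult_nth qcnj_mult)
qed

text \<open>
  One step of the Cholesky algorithm: splitting off the normalized \<open>k\<close>-th column of \<open>S\<close> leaves the
  Schur complement of \<open>S $ k $ k\<close>, bordered by the \<open>k\<close>-th row and column of the identity.  Rows
  that already agree with the identity have a zero in column \<open>k\<close> and survive.
\<close>

lemma posdef_clear_row:
  fixes S :: "quat^'n^'n"
  assumes S: "S \<in> posdef_mats"
  obtains A T where "A \<in> GL" "T \<in> posdef_mats" "S = gl_act A T" "T $ k = mat 1 $ k"
    "\<forall>i. i \<noteq> k \<and> S $ i = mat 1 $ i \<longrightarrow> T $ i = mat 1 $ i"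
proof -
  obtain r where r: "0 < r" "S $ k $ k = of_real r"
    using posdef_diagonal[OF S] .
  have cnj: "qcnj (S $ i $ j) = S $ j $ i" for i j
    using posdef_selfadj[OF S] by (metis ctranspose_nth selfadj_mats_iff)
  \<comment> \<open>Dividing by \<open>sqrt r\<close> makes the \<open>k\<close>-th row and column of \<open>c c\<^sup>\<dagger>\<close> equal to those of \<open>S\<close>.\<close>
  define c where "c = (\<chi> i. (1 / sqrt r) *\<^sub>R S $ i $ k)"
  define T where "T = (\<chi> i j. if i = k \<or> j = k then mat 1 $ i $ j
      else S $ i $ j - (1 / r) *\<^sub>R (S $ i $ k * S $ k $ j))"
  define A where "A = replace_col k c"
  have A: "A \<in> GL"
    unfolding A_def using r by (intro replace_col_GL) (simp add: c_def)
  have sqrt: "sqrt r * sqrt r = r"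
    using r by simp
  have ST: "S = gl_act A T"
    using r sqrt unfolding A_def
    by (simp add: vec_eq_iff gl_act_replace_col_nth)
       (auto simp: T_def c_def mat_nth cnj of_real_def)
  moreover from ST have "T = gl_act (matrix_inv A) S"
    using A by simp
  then have "T \<in> posdef_mats"
    using gl_act_posdef[OF matrix_inv_GL[OF A] S] by simp
  moreover have "T $ k = mat 1 $ k"
    by (simp add: T_def vec_eq_iff)
  moreover have "T $ i = mat 1 $ i" if "i \<noteq> k" "S $ i = mat 1 $ i" for i
    using that by (simp add: T_def vec_eq_iff mat_nth)
  ultimately show ?thesis
    using that[OF A] by blast
qed

lemma posdef_clear_rows:
  fixes S :: "quat^'n^'n"
  assumes "finite K" "S \<in> posdef_mats"
  shows "\<exists>A\<in>GL. \<exists>T\<in>posdef_mats. S = gl_act A T \<and> (\<forall>i\<in>K. T $ i = mat 1 $ i)"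
  using assms(1)
proof (induction K rule: finite_induct)
  case empty
  have "mat 1 \<in> GL"
    by (rule GL_I[of _ "mat 1"]) simp_all
  then show ?case
    using assms(2) by (intro bexI[of _ "mat 1"] bexI[of _ S]) auto
next
  case (insert k K)
  then obtain A T where AT: "A \<in> GL" "T \<in> posdef_mats" "S = gl_act A T"
      "\<forall>i\<in>K. T $ i = mat 1 $ i"
    by blast
  obtain B R where BR: "B \<in> GL" "R \<in> posdef_mats" "T = gl_act B R" "R $ k = mat 1 $ k"
      "\<forall>i. i \<noteq> k \<and> T $ i = mat 1 $ i \<longrightarrow> R $ i = mat 1 $ i"
    using posdef_clear_row[OF AT(2), of k] .
  have "A ** B \<in> GL" "S = gl_act (A ** B) R"
    using AT BR by (simp_all add: GL_mult gl_act_gl_act)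
  moreover have "\<forall>i\<in>insert k K. R $ i = mat 1 $ i"
    using AT(4) BR(4,5) by (metis insert_iff)
  ultimately show ?case
    using BR(2) by blast
qed

lemma posdef_factorization:
  fixes S :: "quat^'n^'n"
  assumes "S \<in> posdef_mats"
  shows "\<exists>A\<in>GL. S = gl_act A (mat 1)"
proof -
  obtain A T where "A \<in> GL" "S = gl_act A T" "\<forall>i\<in>UNIV. T $ i = mat 1 $ i"
    using posdef_clear_rows[OF finite assms, of UNIV] by blast
  moreover from this have "T = mat 1"
    by (simp add: vec_eq_iff[of T])
  ultimately show ?thesis
    by blast
qed

lemma posdef_GL: "posdef_mats \<subseteq> GL"
proof
  fix S :: "quat^'n^'n"
  assume "S \<in> posdef_mats"
  then obtain A where "A \<in> GL" "S = A ** ctranspose A"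
    using posdef_factorization by (force simp: gl_act_def)
  then show "S \<in> GL"
    by (simp add: GL_mult GL_ctranspose)
qed

text \<open>
  The identity is an interior point, as \<open>|H \<bullet> x x\<^sup>\<dagger>| \<le> norm H * (norm x)\<^sup>2\<close> by Cauchy-Schwarz;
  the action moves this neighbourhood of the identity to any other point.
\<close>

lemma openin_posdef_mats: "openin (top_of_set selfadj_mats) (posdef_mats :: (quat^'n^'n) set)"
proof (subst openin_subopen, intro ballI)
  fix S :: "quat^'n^'n"
  assume S: "S \<in> posdef_mats"
  then obtain A where A: "A \<in> GL" "S = gl_act A (mat 1)"
    using posdef_factorization by blast
  let ?h = "\<lambda>T. gl_act (matrix_inv A) (T - S)"
  interpret bounded_linear "gl_act (matrix_inv A)"
    by (rule bounded_linear_gl_act)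
  have "openin (top_of_set selfadj_mats) (selfadj_mats \<inter> ?h -` ball 0 1)"
    by (intro continuous_openin_preimage_gen continuous_on continuous_intros open_ball)
  moreover have "S \<in> selfadj_mats \<inter> ?h -` ball 0 1"
    using S by (simp add: posdef_selfadj zero)
  moreover have "T \<in> posdef_mats" if T: "T \<in> selfadj_mats" "norm (?h T) < 1" for T
  proof -
    have "mat 1 + ?h T = gl_act (matrix_inv A) T"
      using A by (simp add: diff)
    moreover have "mat 1 + ?h T \<in> posdef_mats"
      unfolding posdef_mats_iff
    proof (intro conjI allI impI)
      show "mat 1 + ?h T \<in> selfadj_mats"
        by (simp add: \<open>mat 1 + ?h T = _\<close> gl_act_selfadj T)
      fix x :: "quat^'n"
      assume "x \<noteq> 0"
      have "\<bar>?h T \<bullet> outer x\<bar> \<le> norm (?h T) * (norm x)\<^sup>2"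
        using Cauchy_Schwarz_ineq2[of "?h T" "outer x"] by (simp add: norm_outer)
      also have "\<dots> < 1 * (norm x)\<^sup>2"
        using T \<open>x \<noteq> 0\<close> by (intro mult_strict_right_mono) auto
      finally show "0 < (mat 1 + ?h T) \<bullet> outer x"
        by (simp add: inner_add_left inner_mat_1_outer)
    qed
    ultimately show ?thesis
      using A gl_act_posdef[of A] by (metis gl_act_cancel(1))
  qed
  ultimately show "\<exists>U. openin (top_of_set selfadj_mats) U \<and> S \<in> U \<and> U \<subseteq> posdef_mats"
    by (intro exI[of _ "selfadj_mats \<inter> ?h -` ball 0 1"]) auto
qed

section \<open>The metric at a point\<close>

lemma metric_via_eq_inner:
  "metric_via A u v = gl_act (matrix_inv A) u \<bullet> gl_act (matrix_inv A) v"
  by (simp add: metric_via_def mat_inner_eq_inner gl_act_def)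

text \<open>
  With \<open>B = A\<^sup>-\<^sup>1\<close> and \<open>S = A A\<^sup>\<dagger>\<close> the defining product is \<open>Re tr (B u B\<^sup>\<dagger> B v B\<^sup>\<dagger>)\<close>; moving the
  last factor to the front turns both occurrences of \<open>B\<^sup>\<dagger> B\<close> into \<open>S\<^sup>-\<^sup>1\<close>.  The right-hand side does
  not mention \<open>A\<close>, which is why the choice of \<open>A\<close> is immaterial.
\<close>

lemma metric_via_eq_trace:
  fixes A :: "quat^'n^'n"
  assumes A: "A \<in> GL" "S = gl_act A (mat 1)" and v: "v \<in> selfadj_mats"
  shows "metric_via A u v = qRe (trace (matrix_inv S ** u ** matrix_inv S ** v))"
proof -
  define B where "B = matrix_inv A"
  have S: "matrix_inv S = ctranspose B ** B"
    using A by (simp add: gl_act_def matrix_inv_mult GL_ctranspose matrix_inv_ctranspose B_def)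
  have "metric_via A u v = qRe (trace (B ** u ** ctranspose B ** B ** v ** ctranspose B))"
    using v by (simp add: metric_via_def mat_inner_def ctranspose_mult B_def[symmetric]
        selfadj_mats_iff matrix_mul_assoc)
  also have "\<dots> = qRe (trace (ctranspose B ** (B ** u ** ctranspose B ** B ** v)))"
    by (rule qRe_trace_commute)
  also have "\<dots> = qRe (trace (matrix_inv S ** u ** matrix_inv S ** v))"
    by (simp add: S matrix_mul_assoc)
  finally show ?thesis .
qed

lemma posdef_metric_choice:
  assumes "S \<in> posdef_mats"
  obtains A where "A \<in> GL" "S = gl_act A (mat 1)" "posdef_metric S = metric_via A"
proof
  show "(SOME A. A \<in> GL \<and> S = gl_act A (mat 1)) \<in> GL"
    "S = gl_act (SOME A. A \<in> GL \<and> S = gl_act A (mat 1)) (mat 1)"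
    using someI_ex[of "\<lambda>A. A \<in> GL \<and> S = gl_act A (mat 1)"] posdef_factorization[OF assms]
    by blast+
qed (simp add: posdef_metric_def)

lemma posdef_metric_eq_trace:
  assumes "S \<in> posdef_mats" "v \<in> selfadj_mats"
  shows "posdef_metric S u v = qRe (trace (matrix_inv S ** u ** matrix_inv S ** v))"
  using assms by (metis posdef_metric_choice metric_via_eq_trace)

lemma posdef_metric_eq_metric_via:
  assumes "A \<in> GL" "gl_act A (mat 1) \<in> posdef_mats" "v \<in> selfadj_mats"
  shows "posdef_metric (gl_act A (mat 1)) u v = metric_via A u v"
  using assms by (simp add: posdef_metric_eq_trace metric_via_eq_trace)

lemma scalar_product_posdef_metric:
  assumes "S \<in> posdef_mats"
  shows "scalar_product_on selfadj_mats (posdef_metric S)"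
proof -
  obtain A where A: "A \<in> GL" "posdef_metric S = metric_via A"
    using posdef_metric_choice[OF assms] .
  interpret bounded_linear "gl_act (matrix_inv A)"
    by (rule bounded_linear_gl_act)
  have "gl_act (matrix_inv A) u \<noteq> 0" if "u \<noteq> 0" for u
  proof
    assume "gl_act (matrix_inv A) u = 0"
    then have "gl_act A (gl_act (matrix_inv A) u) = 0"
      by (simp add: linear_0 bounded_linear.linear bounded_linear_gl_act)
    then show False
      using A that by simp
  qed
  then show ?thesis
    by (simp add: scalar_product_on_def A metric_via_eq_inner add scaleR inner_add_left
        inner_add_right inner_commute)
qed

section \<open>Calculus of functions of class \<open>C\<^sup>k\<close>\<close>

lemma Ck_on_cong:
  assumes "\<And>x. x \<in> U \<Longrightarrow> f x = g x"
  shows "Ck_on k V U f \<longleftrightarrow> Ck_on k V U g"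
proof (cases k)
  case 0
  then show ?thesis
    using assms by (simp cong: continuous_on_cong)
next
  case (Suc m)
  have "(f has_derivative D) (at x within U) \<longleftrightarrow> (g has_derivative D) (at x within U)"
    if "x \<in> U" for x D
    using that assms has_derivative_transform by metis
  then show ?thesis
    by (simp add: Suc cong: ball_cong)
qed

text \<open>
  In the product rule the derivative contains the undifferentiated factors, whose order of
  differentiability has to be lowered by one before the induction hypothesis applies.
\<close>

lemma Ck_on_SucD: "Ck_on (Suc k) V U f \<Longrightarrow> Ck_on k V U f"
proof (induction k arbitrary: f)
  case 0
  then show ?case
    by (auto simp: continuous_on_eq_continuous_within intro: has_derivative_continuous)
next
  case (Suc k)
  then show ?case
    by (subst Ck_on.simps) (subst (asm) Ck_on.simps, blast)
qed

lemma Ck_on_const: "Ck_on k V U (\<lambda>_. c)"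
proof (induction k arbitrary: c)
  case (Suc k)
  then show ?case
    by (auto intro!: exI[of _ "\<lambda>_ _. 0"])
qed simp

lemma Ck_on_add: "Ck_on k V U f \<Longrightarrow> Ck_on k V U g \<Longrightarrow> Ck_on k V U (\<lambda>x. f x + g x)"
proof (induction k arbitrary: f g)
  case 0
  then show ?case
    by (simp add: continuous_on_add)
next
  case (Suc k)
  from Suc.prems obtain D E where D:
      "\<forall>x\<in>U. (f has_derivative D x) (at x within U)" "\<forall>v\<in>V. Ck_on k V U (\<lambda>x. D x v)"
      "\<forall>x\<in>U. (g has_derivative E x) (at x within U)" "\<forall>v\<in>V. Ck_on k V U (\<lambda>x. E x v)"
    by auto
  then have "\<forall>x\<in>U. ((\<lambda>x. f x + g x) has_derivative (\<lambda>v. D x v + E x v)) (at x within U)"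
    by (auto intro: has_derivative_add)
  then show ?case
    using D Suc.IH by (auto intro!: exI[of _ "\<lambda>x v. D x v + E x v"])
qed

lemma Ck_on_bounded_linear:
  assumes "bounded_linear L"
  shows "Ck_on k V U f \<Longrightarrow> Ck_on k V U (\<lambda>x. L (f x))"
proof (induction k arbitrary: f)
  case 0
  then show ?case
    using bounded_linear.continuous_on[OF assms] by auto
next
  case (Suc k)
  from Suc.prems obtain D where D:
      "\<forall>x\<in>U. (f has_derivative D x) (at x within U)" "\<forall>v\<in>V. Ck_on k V U (\<lambda>x. D x v)"
    by auto
  then have "\<forall>x\<in>U. ((\<lambda>x. L (f x)) has_derivative (\<lambda>v. L (D x v))) (at x within U)"
    by (auto intro: bounded_linear.has_derivative[OF assms])
  then show ?case
    using D Suc.IH by (auto intro!: exI[of _ "\<lambda>x v. L (D x v)"])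
qed

lemma Ck_on_bounded_bilinear:
  assumes "bounded_bilinear h"
  shows "Ck_on k V U f \<Longrightarrow> Ck_on k V U g \<Longrightarrow> Ck_on k V U (\<lambda>x. h (f x) (g x))"
proof (induction k arbitrary: f g)
  case 0
  then show ?case
    using bounded_bilinear.continuous_on[OF assms] by auto
next
  case (Suc k)
  from Suc.prems obtain D E where D:
      "\<forall>x\<in>U. (f has_derivative D x) (at x within U)" "\<forall>v\<in>V. Ck_on k V U (\<lambda>x. D x v)"
      "\<forall>x\<in>U. (g has_derivative E x) (at x within U)" "\<forall>v\<in>V. Ck_on k V U (\<lambda>x. E x v)"
    by auto
  then have "\<forall>x\<in>U. ((\<lambda>x. h (f x) (g x)) has_derivative (\<lambda>v. h (f x) (E x v) + h (D x v) (g x)))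
      (at x within U)"
    by (auto intro: bounded_bilinear.FDERIV[OF assms])
  moreover have "\<forall>v\<in>V. Ck_on k V U (\<lambda>x. h (f x) (E x v) + h (D x v) (g x))"
    using D Suc.IH Suc.prems[THEN Ck_on_SucD] by (auto intro!: Ck_on_add)
  ultimately show ?case
    by (auto intro!: exI[of _ "\<lambda>x v. h (f x) (E x v) + h (D x v) (g x)"])
qed

section \<open>Smoothness of the metric\<close>

lemma matrix_inv_resolvent:
  assumes "S \<in> GL" "T \<in> GL"
  shows "matrix_inv T - matrix_inv S = - (matrix_inv T ** (T - S) ** matrix_inv S)"
proof -
  interpret bounded_bilinear "(**) :: quat^'n^'n \<Rightarrow> quat^'n^'n \<Rightarrow> quat^'n^'n"
    by (rule bounded_bilinear_matrix_mult)
  show ?thesis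
    by (simp add: diff_right diff_left GL_inverse assms matrix_mul_assoc[symmetric])
qed

text \<open>
  The resolvent identity is used twice.  Near \<open>S\<close> it bounds the norm of \<open>T\<^sup>-\<^sup>1\<close> by twice that of
  \<open>S\<^sup>-\<^sup>1\<close>, whence inversion is continuous at \<open>S\<close>; then it exhibits the error of the linear
  approximation as \<open>(T\<^sup>-\<^sup>1 - S\<^sup>-\<^sup>1) (T - S) S\<^sup>-\<^sup>1\<close> up to sign, which is small compared with \<open>T - S\<close> by
  that continuity.
\<close>

lemma has_derivative_matrix_inv:
  fixes S :: "quat^'n^'n"
  assumes U: "U \<subseteq> GL" and S: "S \<in> U"
  shows "(matrix_inv has_derivative (\<lambda>v. - (matrix_inv S ** v ** matrix_inv S))) (at S within U)"
proof -
  interpret bounded_bilinear "(**) :: quat^'n^'n \<Rightarrow> quat^'n^'n \<Rightarrow> quat^'n^'n"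
    by (rule bounded_bilinear_matrix_mult)
  obtain K where K: "0 < K" "\<And>(X :: quat^'n^'n) (Y :: quat^'n^'n). norm (X ** Y) \<le> norm X * norm Y * K"
    using pos_bounded by blast
  have bound3: "norm (X ** Y ** Z) \<le> norm X * norm Y * norm Z * K\<^sup>2" for X Y Z :: "quat^'n^'n"
  proof -
    have "norm (X ** Y ** Z) \<le> norm (X ** Y) * norm Z * K"
      by (rule K)
    also have "\<dots> \<le> (norm X * norm Y * K) * norm Z * K"
      using K by (intro mult_right_mono) auto
    finally show ?thesis
      by (simp add: power2_eq_square mult_ac)
  qed
  let ?J = "matrix_inv :: quat^'n^'n \<Rightarrow> quat^'n^'n"
  define c where "c = norm (?J S) * K\<^sup>2"
  have c: "0 \<le> c"
    by (simp add: c_def)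
  have resolvent: "?J T - ?J S = - (?J T ** (T - S) ** ?J S)" if "T \<in> U" for T
    using that U S by (intro matrix_inv_resolvent) auto
  have diff_bound: "norm (?J T - ?J S) \<le> norm (?J T) * norm (T - S) * c" if "T \<in> U" for T
    using bound3[of "?J T" "T - S" "?J S"] by (simp add: resolvent[OF that] c_def mult_ac)
  have lim: "((\<lambda>T. norm (T - S)) \<longlongrightarrow> 0) (at S within U)"
    by (auto intro!: tendsto_eq_intros)
  have "((\<lambda>T. norm (T - S) * c) \<longlongrightarrow> 0) (at S within U)"
    using tendsto_mult_left_zero[OF lim] .
  then have "\<forall>\<^sub>F T in at S within U. norm (T - S) * c < 1 / 2"
    by (rule order_tendstoD) simp
  moreover have "\<forall>\<^sub>F T in at S within U. T \<in> U"
    by (simp add: eventually_at_filter)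
  ultimately have "\<forall>\<^sub>F T in at S within U. norm (?J T - ?J S) \<le> norm (T - S) * (2 * norm (?J S) * c)"
  proof eventually_elim
    case (elim T)
    have "norm (?J T) * (norm (T - S) * c) \<le> norm (?J T) * (1 / 2)"
      using elim by (intro mult_left_mono) auto
    then have "norm (?J T - ?J S) \<le> norm (?J T) / 2"
      using diff_bound[OF elim(2)] by (simp add: mult_ac)
    then have "norm (?J T) \<le> 2 * norm (?J S)"
      using norm_triangle_sub[of "?J T" "?J S"] by simp
    then have "norm (?J T) * (norm (T - S) * c) \<le> 2 * norm (?J S) * (norm (T - S) * c)"
      using c by (intro mult_right_mono) auto
    then show ?case
      using diff_bound[OF elim(2)] by (simp add: mult_ac)
  qed
  moreover have "((\<lambda>T. norm (T - S) * (2 * norm (?J S) * c)) \<longlongrightarrow> 0) (at S within U)"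
    using tendsto_mult_left_zero[OF lim] .
  ultimately have "((\<lambda>T. ?J T - ?J S) \<longlongrightarrow> 0) (at S within U)"
    by (rule Lim_null_comparison)
  then have H: "((\<lambda>T. norm (?J T - ?J S) * c) \<longlongrightarrow> 0) (at S within U)"
    by (intro tendsto_mult_left_zero tendsto_norm_zero)
  show ?thesis
  proof (rule has_derivativeI_sandwich[OF zero_less_one _ _ H])
    show "bounded_linear (\<lambda>v. - (?J S ** v ** ?J S))"
      by (rule bounded_linear_minus[OF bounded_linear_two_sided_mult])
    fix T
    assume T: "T \<in> U" "T \<noteq> S"
    have "?J T - ?J S - - (?J S ** (T - S) ** ?J S) = - ((?J T - ?J S) ** (T - S) ** ?J S)"
      by (subst resolvent[OF T(1)]) (simp add: diff_left)
    then have "norm (?J T - ?J S - - (?J S ** (T - S) ** ?J S)) \<le> norm (?J T - ?J S) * c * norm (T - S)"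
      using bound3[of "?J T - ?J S" "T - S" "?J S"] by (simp add: c_def mult_ac)
    then show "norm (?J T - ?J S - - (?J S ** (T - S) ** ?J S)) / norm (T - S)
        \<le> norm (?J T - ?J S) * c"
      using T by (simp add: field_simps)
  qed
qed

text \<open>
  The derivative of the inversion is a polynomial in the inversion, so each order of
  differentiability gives the next.
\<close>

lemma Ck_on_matrix_inv:
  fixes U :: "(quat^'n^'n) set"
  assumes "U \<subseteq> GL"
  shows "Ck_on k V U matrix_inv"
proof (induction k)
  case 0
  show ?case
    using has_derivative_matrix_inv[OF assms]
    by (auto simp: continuous_on_eq_continuous_within intro: has_derivative_continuous)
next
  case (Suc k)
  have "Ck_on k V U (\<lambda>S. - (matrix_inv S ** v ** matrix_inv S))" for v
    by (intro Ck_on_bounded_linear[OF bounded_linear_minus[OF bounded_linear_ident]]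
        Ck_on_bounded_bilinear[OF bounded_bilinear_matrix_mult] Ck_on_const Suc)
  then show ?case
    using has_derivative_matrix_inv[OF assms]
    by (auto intro!: exI[of _ "\<lambda>S v. - (matrix_inv S ** v ** matrix_inv S)"])
qed

lemma smooth_on_trace_metric:
  fixes U :: "(quat^'n^'n) set"
  assumes "U \<subseteq> GL" "smooth_on V U X" "smooth_on V U Y"
  shows "smooth_on V U (\<lambda>S. qRe (trace (matrix_inv S ** X S ** matrix_inv S ** Y S)))"
proof -
  have "linear (\<lambda>Z :: quat^'n^'n. qRe (trace Z))"
    by (rule linearI) (simp_all add: trace_def qRe_sum sum.distrib sum_distrib_left)
  then have "bounded_linear (\<lambda>Z :: quat^'n^'n. qRe (trace Z))"
    by (simp only: linear_conv_bounded_linear)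
  then show ?thesis
    using assms unfolding smooth_on_def
    by (intro allI Ck_on_bounded_linear[of "\<lambda>Z. qRe (trace Z)"]
        Ck_on_bounded_bilinear[OF bounded_bilinear_matrix_mult] Ck_on_matrix_inv) auto
qed

lemma riemannian_metric_posdef:
  "riemannian_metric_on selfadj_mats (posdef_mats :: (quat^'n^'n) set) posdef_metric"
  unfolding riemannian_metric_on_def
proof (intro conjI allI impI ballI)
  fix X Y :: "quat^'n^'n \<Rightarrow> quat^'n^'n"
  assume XY: "X ` posdef_mats \<subseteq> selfadj_mats \<and> smooth_on selfadj_mats posdef_mats X \<and>
    Y ` posdef_mats \<subseteq> selfadj_mats \<and> smooth_on selfadj_mats posdef_mats Y"
  then have "posdef_metric S (X S) (Y S) =
      qRe (trace (matrix_inv S ** X S ** matrix_inv S ** Y S))" if "S \<in> posdef_mats" for S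
    using that by (intro posdef_metric_eq_trace) auto
  then show "smooth_on selfadj_mats posdef_mats (\<lambda>S. posdef_metric S (X S) (Y S))"
    using XY smooth_on_trace_metric[OF posdef_GL, of selfadj_mats X Y]
    unfolding smooth_on_def by (simp cong: Ck_on_cong)
qed (simp_all add: subspace_selfadj_mats openin_posdef_mats scalar_product_posdef_metric)

section \<open>Invariance\<close>

text \<open>
  If \<open>B\<close> is a factor of \<open>S\<close> then \<open>A B\<close> is one of \<open>A \<cdot> S\<close>, and \<open>(A B)\<^sup>-\<^sup>1\<close> undoes the effect of \<open>A\<close> on
  tangent vectors; the action is linear, so it is its own differential.
\<close>

lemma posdef_metric_invariant:
  fixes A :: "quat^'n^'n"
  assumes A: "A \<in> GL"
  shows "metric_invariant_under selfadj_mats posdef_mats posdef_metric (gl_act A)"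
  unfolding metric_invariant_under_def
proof (intro conjI ballI exI[of _ "gl_act A"])
  show "gl_act A ` posdef_mats \<subseteq> posdef_mats"
    using gl_act_posdef[OF A] by blast
  show "gl_act A ` selfadj_mats \<subseteq> selfadj_mats"
    using gl_act_selfadj by blast
  fix S :: "quat^'n^'n"
  assume S: "S \<in> posdef_mats"
  show "(gl_act A has_derivative gl_act A) (at S within posdef_mats)"
    by (rule bounded_linear_imp_has_derivative[OF bounded_linear_gl_act])
  fix u v :: "quat^'n^'n"
  assume uv: "u \<in> selfadj_mats" "v \<in> selfadj_mats"
  obtain B where B: "B \<in> GL" "S = gl_act B (mat 1)" "posdef_metric S = metric_via B"
    using posdef_metric_choice[OF S] .
  have inv: "gl_act (matrix_inv (A ** B)) (gl_act A w) = gl_act (matrix_inv B) w" for w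
    by (simp add: matrix_inv_mult A B gl_act_gl_act[symmetric])
  have "gl_act A S = gl_act (A ** B) (mat 1)"
    by (simp add: B(2) gl_act_gl_act)
  then have "posdef_metric (gl_act A S) (gl_act A u) (gl_act A v) =
      metric_via (A ** B) (gl_act A u) (gl_act A v)"
    using posdef_metric_eq_metric_via[of "A ** B" "gl_act A v" "gl_act A u"]
      gl_act_posdef[OF A S] gl_act_selfadj[OF uv(2)] GL_mult[OF A B(1)] by simp
  also have "\<dots> = posdef_metric S u v"
    by (simp add: metric_via_eq_inner inv B(3))
  finally show "posdef_metric (gl_act A S) (gl_act A u) (gl_act A v) = posdef_metric S u v" .
qed

theorem proposition1:
  shows
    "(\<forall>S \<in> (posdef_mats :: (quat^'n^'n) set).
        (\<exists>A\<in>GL. S = gl_act A (mat 1)) \<and>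
        scalar_product_on selfadj_mats (posdef_metric S) \<and>
        (\<forall>A\<in>GL. S = gl_act A (mat 1) \<longrightarrow>
          (\<forall>u\<in>selfadj_mats. \<forall>v\<in>selfadj_mats. posdef_metric S u v = metric_via A u v)))
     \<and>
     ((\<forall>S \<in> (posdef_mats :: (quat^'n^'n) set). \<forall>u\<in>selfadj_mats. \<forall>v\<in>selfadj_mats.
          posdef_metric S u v = qRe (trace (matrix_inv S ** u ** matrix_inv S ** v))) \<and>
      riemannian_metric_on selfadj_mats (posdef_mats :: (quat^'n^'n) set) posdef_metric)
     \<and>
     (\<forall>A \<in> (GL :: (quat^'n^'n) set).
        metric_invariant_under selfadj_mats posdef_mats posdef_metric (gl_act A))"
proof (intro conjI ballI impI)
  fix S :: "quat^'n^'n"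
  assume S: "S \<in> posdef_mats"
  show "\<exists>A\<in>GL. S = gl_act A (mat 1)"
    by (rule posdef_factorization[OF S])
  show "scalar_product_on selfadj_mats (posdef_metric S)"
    by (rule scalar_product_posdef_metric[OF S])
  fix u v :: "quat^'n^'n"
  assume v: "v \<in> selfadj_mats"
  show "posdef_metric S u v = qRe (trace (matrix_inv S ** u ** matrix_inv S ** v))"
    by (rule posdef_metric_eq_trace[OF S v])
  fix A :: "quat^'n^'n"
  assume "A \<in> GL" "S = gl_act A (mat 1)"
  then show "posdef_metric S u v = metric_via A u v"
    using S v posdef_metric_eq_metric_via by metis
qed (simp_all add: riemannian_metric_posdef posdef_metric_invariant)

end
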